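(* Let $m,l\ge0$ and $k\ge1$ be integers. Then for every $n\ge1$, \[ f_{v_{m,l}}(n+1,k)-f_{v_{m,l}}(n,k)=\sum_{j=0}^{m+l-1}\binom{n}{j}f_{v_{m,l}}(n+1-j,k-1). \]
   Context: For integers $k,n\ge 0$, a word is an element of $[k]^n$, where $[k]=\{1,\dots,k\}$ is totally ordered. A word $\sigma\in[k]^n$ contains a word $\tau$ of length $p$ if there are indices $1\le i_1<\dots<i_p\le n$ such that for all $1\le a,b\le p$ and each relation $\phi\in\{<,=,>\}$, $\sigma(i_a)\,\phi\,\sigma(i_b)$ holds iff $\tau(a)\,\phi\,\tau(b)$ holds; otherwise $\sigma$ avoids $\tau$. For $m,l\ge0$, $v_{m,l}$ denotes the word consisting of $m$ copies of $1$, followed by one letter $2$, followed by $l$ copies of $1$. $f_{v_{m,l}}(n,k)$ is the number of words in $[k]^n$ avoiding $v_{m,l}$. *)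

theory Defs
  imports Complex_Main
begin

definition words :: "nat \<Rightarrow> nat \<Rightarrow> nat list set" where
  "words k n = {\<sigma>. length \<sigma> = n \<and> set \<sigma> \<subseteq> {1..k}}"

text \<open>Positions are counted from \<open>0\<close>, as usual for lists.\<close>

definition contains :: "nat list \<Rightarrow> nat list \<Rightarrow> bool" where
  "contains \<sigma> \<tau> \<longleftrightarrow>
    (\<exists>i :: nat \<Rightarrow> nat.
      strict_mono_on {..<length \<tau>} i \<and>
      (\<forall>a<length \<tau>. i a < length \<sigma>) \<and>
      (\<forall>a<length \<tau>. \<forall>b<length \<tau>.
        (\<sigma> ! i a < \<sigma> ! i b \<longleftrightarrow> \<tau> ! a < \<tau> ! b) \<and>
        (\<sigma> ! i a = \<sigma> ! i b \<longleftrightarrow> \<tau> ! a = \<tau> ! b) \<and>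
        (\<sigma> ! i a > \<sigma> ! i b \<longleftrightarrow> \<tau> ! a > \<tau> ! b)))"

definition avoids :: "nat list \<Rightarrow> nat list \<Rightarrow> bool" where
  "avoids \<sigma> \<tau> \<longleftrightarrow> \<not> contains \<sigma> \<tau>"

definition v :: "nat \<Rightarrow> nat \<Rightarrow> nat list" where
  "v m l = replicate m 1 @ [2] @ replicate l 1"

definition num_avoiding :: "nat list \<Rightarrow> nat \<Rightarrow> nat \<Rightarrow> nat" where
  "num_avoiding \<tau> n k = card {\<sigma> \<in> words k n. avoids \<sigma> \<tau>}"

end

theory Submission
  imports Defs "HOL-Library.Sublist"
begin

text \<open>
  Put \<open>s = m + l > 0\<close>. A word avoids \<open>v m l\<close> iff the word \<open>w\<close> of its letters other than \<open>1\<close> does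
  and no letter of \<open>w\<close> has at least \<open>m\<close> ones to its left and at least \<open>l\<close> ones to its right. If there
  are \<open>j\<close> ones, then they leave \<open>j + 1\<close> gaps for the letters of \<open>w\<close>, all of them allowed if \<open>j < s\<close>;
  otherwise only the first \<open>m\<close> and the last \<open>l\<close> gaps are. With \<open>p\<close> letters in \<open>w\<close> there are
  thus \<open>(min (j + 1) s + p - 1) choose p\<close> such words. Summing over \<open>p\<close> expresses the number of
  avoiders of length \<open>n\<close> over \<open>k\<close> letters by the numbers over \<open>k - 1\<close> letters; in the difference of
  two consecutive sums, the terms with \<open>p\<close> letters cancel if there are at least \<open>s\<close> ones, and the
  others combine by Pascal's rule.
\<close>

section \<open>Occurrences at a fixed lower letter\<close>

text \<open>
  For \<open>m + l > 0\<close> this says that \<open>v m l\<close> occurs with \<open>x\<close> in the role of the letter \<open>1\<close>.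
\<close>

definition occurs :: "'a::linorder \<Rightarrow> nat \<Rightarrow> nat \<Rightarrow> 'a list \<Rightarrow> bool" where
  "occurs x m l \<sigma> \<longleftrightarrow>
    (\<exists>xs y ys. \<sigma> = xs @ y # ys \<and> x < y \<and> m \<le> count_list xs x \<and> l \<le> count_list ys x)"

lemma occurs_Nil [simp]: "\<not> occurs x m l []"
  by (simp add: occurs_def)

text \<open>The first letter is either the peak or lies before it; in the latter case an
  \<open>x\<close> supplies one of the \<open>m\<close> copies. For \<open>m = 0\<close> truncated
  subtraction rightly keeps \<open>0\<close>.\<close>

lemma occurs_Cons:
  "occurs x m l (z # \<sigma>) \<longleftrightarrow>
    (m = 0 \<and> x < z \<and> l \<le> count_list \<sigma> x) \<or> occurs x (if z = x then m - 1 else m) l \<sigma>"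
  (is "?L \<longleftrightarrow> ?R")
proof
  assume ?L
  then obtain xs y ys where s: "z # \<sigma> = xs @ y # ys" "x < y" "m \<le> count_list xs x" "l \<le> count_list ys x"
    unfolding occurs_def by blast
  show ?R
  proof (cases xs)
    case Nil
    then show ?thesis using s by simp
  next
    case (Cons a xs')
    then have "(if z = x then m - 1 else m) \<le> count_list xs' x" and "\<sigma> = xs' @ y # ys"
      using s by (auto split: if_splits)
    then show ?thesis using s(2,4) unfolding occurs_def by blast
  qed
next
  assume ?R
  then consider "m = 0" "x < z" "l \<le> count_list \<sigma> x" | "occurs x (if z = x then m - 1 else m) l \<sigma>"
    by blast
  then show ?L
  proof cases
    case 1
    then show ?thesis unfolding occurs_def by (intro exI[of _ "[]"] exI[of _ z] exI[of _ \<sigma>]) simp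
  next
    case 2
    then obtain xs y ys where s: "\<sigma> = xs @ y # ys" "x < y"
      "(if z = x then m - 1 else m) \<le> count_list xs x" "l \<le> count_list ys x"
      unfolding occurs_def by blast
    then have "m \<le> count_list (z # xs) x" by (auto split: if_splits)
    then show ?thesis using s unfolding occurs_def
      by (intro exI[of _ "z # xs"] exI[of _ y] exI[of _ ys]) simp
  qed
qed

lemma occurs_imp_mem:
  assumes "occurs x m l \<sigma>" "0 < m + l"
  shows "x \<in> set \<sigma>"
proof -
  obtain xs y ys where "\<sigma> = xs @ y # ys" "m \<le> count_list xs x" "l \<le> count_list ys x"
    using assms(1) unfolding occurs_def by blast
  then have "0 < count_list \<sigma> x" using assms(2) by (cases "y = x") auto
  then show ?thesis by (metis count_list_0_iff less_irrefl)
qed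

lemma count_list_filter: "P x \<Longrightarrow> count_list (filter P xs) x = count_list xs x"
  by (induction xs) auto

text \<open>Neither the repeated letter \<open>x\<close> nor the peak above it can equal
  \<open>a\<close>, so deleting \<open>a\<close> affects no occurrence.\<close>

lemma occurs_filter_neq:
  assumes "a < x"
  shows "occurs x m l (filter (\<lambda>y. y \<noteq> a) \<sigma>) \<longleftrightarrow> occurs x m l \<sigma>"
proof (induction \<sigma> arbitrary: m)
  case Nil
  show ?case by simp
next
  case (Cons z \<sigma>)
  have "count_list (filter (\<lambda>y. y \<noteq> a) \<sigma>) x = count_list \<sigma> x"
    using assms by (intro count_list_filter) simp
  moreover have "a \<noteq> x" "\<not> x < a" using assms by auto
  ultimately show ?case by (cases "z = a") (simp_all add: occurs_Cons Cons.IH)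
qed

section \<open>Containment of \<open>v m l\<close> in terms of occurrences\<close>

lemma subseq_replicateI:
  assumes "m \<le> count_list xs x"
  shows "subseq (replicate m x) xs"
proof -
  have "subseq (replicate m x) (replicate (count_list xs x) x)"
    using assms by (metis le_add_diff_inverse list_emb_prefix replicate_add subseq_order.refl)
  also have "replicate (count_list xs x) x = filter (\<lambda>y. y = x) xs"
    by (induction xs) auto
  also have "subseq \<dots> xs" by simp
  finally show ?thesis .
qed

text \<open>Translates list embeddings into the index maps that \<open>contains\<close> asks
  for.\<close>

lemma subseq_imp_strict_mono_index:
  assumes "subseq \<tau> \<sigma>"
  shows "\<exists>i::nat \<Rightarrow> nat. strict_mono_on {..<length \<tau>} i \<and>
    (\<forall>a<length \<tau>. i a < length \<sigma> \<and> \<sigma> ! i a = \<tau> ! a)"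
  using assms
proof (induction rule: list_emb.induct)
  case (list_emb_Nil ys)
  then show ?case by (auto simp: strict_mono_on_def)
next
  case (list_emb_Cons xs ys y)
  then obtain i where "strict_mono_on {..<length xs} i"
    "\<forall>a<length xs. i a < length ys \<and> ys ! i a = xs ! a" by blast
  then show ?case
    by (intro exI[of _ "\<lambda>a. Suc (i a)"]) (auto simp: strict_mono_on_def)
next
  case (list_emb_Cons2 x y xs ys)
  then obtain i where "strict_mono_on {..<length xs} i"
    "\<forall>a<length xs. i a < length ys \<and> ys ! i a = xs ! a" by blast
  then show ?case using list_emb_Cons2(1)
    by (intro exI[of _ "\<lambda>a. case a of 0 \<Rightarrow> 0 | Suc a' \<Rightarrow> Suc (i a')"])
       (auto simp: strict_mono_on_def nth_Cons split: nat.splits)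
qed

lemma length_v [simp]: "length (v m l) = Suc (m + l)"
  by (simp add: v_def)

lemma nth_v: "a < Suc (m + l) \<Longrightarrow> v m l ! a = (if a = m then 2 else 1)"
  by (auto simp: v_def nth_append nth_Cons split: nat.splits)

lemma count_list_ge:
  assumes "inj_on h A" "\<And>a. a \<in> A \<Longrightarrow> h a < length xs \<and> xs ! h a = x"
  shows "card A \<le> count_list xs x"
proof -
  have "card A = card (h ` A)" using assms(1) by (simp add: card_image)
  also have "\<dots> \<le> card {i. i < length xs \<and> x = xs ! i}"
    using assms(2) by (intro card_mono) auto
  also have "\<dots> = count_list xs x"
    by (simp add: count_list_eq_length_filter length_filter_conv_card)
  finally show ?thesis .
qed

text \<open>The index of the peak cuts the word in two, and injectivity of the index map gives the
  counts on both sides. For \<open>m + l = 0\<close> the pattern has no \<open>1\<close> whose image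
  could serve as \<open>x\<close>.\<close>

lemma contains_v_iff:
  assumes "0 < m + l"
  shows "contains \<sigma> (v m l) \<longleftrightarrow> (\<exists>x. occurs x m l \<sigma>)"
proof
  assume "contains \<sigma> (v m l)"
  then obtain i where mono: "strict_mono_on {..<Suc (m + l)} i"
    and len: "\<And>a. a < Suc (m + l) \<Longrightarrow> i a < length \<sigma>"
    and less: "\<And>a b. a < Suc (m + l) \<Longrightarrow> b < Suc (m + l) \<Longrightarrow>
      \<sigma> ! i a < \<sigma> ! i b \<longleftrightarrow> v m l ! a < v m l ! b"
    and eq: "\<And>a b. a < Suc (m + l) \<Longrightarrow> b < Suc (m + l) \<Longrightarrow>
      \<sigma> ! i a = \<sigma> ! i b \<longleftrightarrow> v m l ! a = v m l ! b"
    unfolding contains_def by auto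
  have monoD: "i a < i b" if "a < b" "b < Suc (m + l)" for a b
    using mono that unfolding strict_mono_on_def by auto
  \<comment> \<open>A position of the letter \<open>1\<close> in the pattern: \<open>0\<close>,
    unless \<open>m = 0\<close> puts the \<open>2\<close> there; position \<open>1\<close> then
    exists because \<open>l > 0\<close>.\<close>
  define c where "c = (if m = 0 then 1 else 0 :: nat)"
  have c: "c < Suc (m + l)" "c \<noteq> m" using assms by (auto simp: c_def)
  define x where "x = \<sigma> ! i c"
  have x: "\<sigma> ! i a = x" if "a < Suc (m + l)" "a \<noteq> m" for a
    using eq[of a c] c that by (simp add: x_def nth_v)
  have "x < \<sigma> ! i m" using less[of c m] c by (simp add: x_def nth_v)
  moreover have "\<sigma> = take (i m) \<sigma> @ \<sigma> ! i m # drop (Suc (i m)) \<sigma>"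
    using len[of m] by (simp add: id_take_nth_drop)
  moreover have "m \<le> count_list (take (i m) \<sigma>) x"
  proof -
    have "card {..<m} \<le> count_list (take (i m) \<sigma>) x"
    proof (rule count_list_ge)
      show "inj_on i {..<m}"
        by (rule strict_mono_on_imp_inj_on, rule monotone_on_subset[OF mono]) auto
      show "i a < length (take (i m) \<sigma>) \<and> take (i m) \<sigma> ! i a = x" if "a \<in> {..<m}" for a
        using that monoD[of a m] len[of a] x[of a] by auto
    qed
    then show ?thesis by simp
  qed
  moreover have "l \<le> count_list (drop (Suc (i m)) \<sigma>) x"
  proof -
    have "card {m<..<Suc (m + l)} \<le> count_list (drop (Suc (i m)) \<sigma>) x"
    proof (rule count_list_ge)
      \<comment> \<open>Indices are shifted to those of the dropped list; as
        \<open>i m < i a\<close>, the subtraction does not truncate.\<close>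
      show "inj_on (\<lambda>a. i a - Suc (i m)) {m<..<Suc (m + l)}"
      proof (rule inj_onI)
        fix a b
        assume ab: "a \<in> {m<..<Suc (m + l)}" "b \<in> {m<..<Suc (m + l)}"
          and e: "i a - Suc (i m) = i b - Suc (i m)"
        then have "i a = i b" using monoD[of m a] monoD[of m b] by auto
        then show "a = b" using ab monoD[of a b] monoD[of b a] by (cases a b rule: linorder_cases) auto
      qed
      show "i a - Suc (i m) < length (drop (Suc (i m)) \<sigma>) \<and>
          drop (Suc (i m)) \<sigma> ! (i a - Suc (i m)) = x" if "a \<in> {m<..<Suc (m + l)}" for a
        using that monoD[of m a] len[of a] x[of a] by auto
    qed
    then show ?thesis by simp
  qed
  ultimately show "\<exists>x. occurs x m l \<sigma>" unfolding occurs_def by blast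
next
  assume "\<exists>x. occurs x m l \<sigma>"
  then obtain x xs y ys where s: "\<sigma> = xs @ y # ys" "x < y" "m \<le> count_list xs x" "l \<le> count_list ys x"
    unfolding occurs_def by blast
  let ?\<tau> = "replicate m x @ [y] @ replicate l x"
  have "subseq ?\<tau> (xs @ [y] @ ys)"
    using s by (intro list_emb_append_mono subseq_replicateI) auto
  then obtain i where i: "strict_mono_on {..<length ?\<tau>} i"
    "\<forall>a<length ?\<tau>. i a < length \<sigma> \<and> \<sigma> ! i a = ?\<tau> ! a"
    using subseq_imp_strict_mono_index[of ?\<tau> \<sigma>] s(1) by auto
  have \<tau>: "?\<tau> ! a = (if a = m then y else x)" if "a < Suc (m + l)" for a
    using that by (auto simp: nth_append nth_Cons split: nat.splits)
  show "contains \<sigma> (v m l)"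
    unfolding contains_def
    using i \<tau> s(2) by (intro exI[of _ i]) (auto simp: nth_v)
qed

lemma avoids_v_iff:
  assumes "0 < m + l"
  shows "avoids \<sigma> (v m l) \<longleftrightarrow> (\<forall>x. \<not> occurs x m l \<sigma>)"
  by (simp add: avoids_def contains_v_iff[OF assms])

section \<open>Separating the letter 1 from the others\<close>

text \<open>Occurrences with \<open>x > 1\<close> are unaffected by deleting the ones, and after the
  deletion no others are left; so only \<open>x = 1\<close> needs separate treatment.\<close>

lemma avoids_v_split_ones:
  assumes "0 < m + l" "\<forall>y\<in>set \<sigma>. 1 \<le> y"
  shows "avoids \<sigma> (v m l) \<longleftrightarrow>
    \<not> occurs 1 m l \<sigma> \<and> avoids (filter (\<lambda>y. y \<noteq> 1) \<sigma>) (v m l)"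
proof -
  have "x \<noteq> 0" if "occurs x m l \<sigma>" for x
    using occurs_imp_mem[OF that assms(1)] assms(2) by auto
  moreover have "1 < x" if "occurs x m l (filter (\<lambda>y. y \<noteq> 1) \<sigma>)" for x
    using occurs_imp_mem[OF that assms(1)] assms(2) by fastforce
  ultimately show ?thesis
    unfolding avoids_v_iff[OF assms(1)]
    by (metis less_one linorder_neqE_nat occurs_filter_neq)
qed

lemma avoids_map_Suc: "avoids (map Suc \<sigma>) \<tau> \<longleftrightarrow> avoids \<sigma> \<tau>"
proof -
  have "contains (map Suc \<sigma>) \<tau> \<longleftrightarrow> contains \<sigma> \<tau>"
    unfolding contains_def by (intro ex_cong1) auto
  then show ?thesis by (simp add: avoids_def)
qed

section \<open>Counting the insertions of a smallest letter\<close>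

text \<open>The length condition forces exactly \<open>j\<close> copies of \<open>x\<close>.\<close>

definition insertions :: "'a::linorder \<Rightarrow> nat \<Rightarrow> nat \<Rightarrow> nat \<Rightarrow> 'a list \<Rightarrow> 'a list set" where
  "insertions x m l j w =
    {\<sigma>. length \<sigma> = j + length w \<and> filter (\<lambda>y. y \<noteq> x) \<sigma> = w \<and> \<not> occurs x m l \<sigma>}"

lemma count_list_add_length_filter_neq:
  "count_list \<sigma> x + length (filter (\<lambda>y. y \<noteq> x) \<sigma>) = length \<sigma>"
  by (induction \<sigma>) auto

lemma insertions_Nil: "insertions x m l j [] = {replicate j x}"
proof -
  have "\<not> occurs x m l (replicate j x)"
    by (induction j arbitrary: m) (auto simp: occurs_Cons)
  moreover have "\<sigma> = replicate j x" if "length \<sigma> = j" "filter (\<lambda>y. y \<noteq> x) \<sigma> = []" for \<sigma>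
    using that by (auto simp: filter_empty_conv intro!: replicate_eqI)
  ultimately show ?thesis by (auto simp: insertions_def)
qed

lemma occurs_all_greater_iff:
  assumes "\<forall>y\<in>set w. x < y"
  shows "occurs x m l w \<longleftrightarrow> m = 0 \<and> l = 0 \<and> w \<noteq> []"
proof (cases w)
  case (Cons y w')
  then have "x < y" using assms by simp
  moreover have "x \<notin> set w" using assms by blast
  ultimately show ?thesis
    using occurs_imp_mem[of x m l w] Cons
    by (cases "m = 0 \<and> l = 0") (auto simp: occurs_Cons)
qed simp

lemma insertions_0:
  assumes "\<forall>y\<in>set w. x < y"
  shows "insertions x m l 0 w = (if m = 0 \<and> l = 0 \<and> w \<noteq> [] then {} else {w})"
proof -
  have eq: "\<sigma> = w" if "length \<sigma> = length w" "filter (\<lambda>y. y \<noteq> x) \<sigma> = w" for \<sigma>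
    using that by (metis filter_id_conv length_filter_less less_irrefl)
  have "filter (\<lambda>y. y \<noteq> x) w = w" using assms by (auto simp: filter_id_conv)
  then have "insertions x m l 0 w = {\<sigma>. \<sigma> = w \<and> \<not> occurs x m l \<sigma>}"
    unfolding insertions_def by (intro Collect_cong) (metis add_0 eq)
  then show ?thesis using occurs_all_greater_iff[OF assms, of m l] by auto
qed

text \<open>A leading \<open>x\<close> uses up one of the \<open>m\<close> copies. A leading
  \<open>y\<close> has all \<open>Suc j\<close> copies to its right, so it is itself a peak iff
  \<open>m = 0\<close> and \<open>l \<le> Suc j\<close>.\<close>

lemma insertions_Suc_Cons:
  assumes "x < y"
  shows "insertions x m l (Suc j) (y # w) =
    (#) x ` insertions x (m - 1) l j (y # w) \<union>
    (if m = 0 \<and> l \<le> Suc j then {} else (#) y ` insertions x m l (Suc j) w)"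
  (is "_ = ?R")
proof -
  have "\<sigma> \<in> insertions x m l (Suc j) (y # w) \<longleftrightarrow> \<sigma> \<in> ?R" for \<sigma>
  proof (cases \<sigma>)
    case Nil
    then show ?thesis by (auto simp: insertions_def)
  next
    case (Cons z \<sigma>')
    show ?thesis
    proof (cases "z = x")
      case True
      have "\<sigma> \<in> insertions x m l (Suc j) (y # w) \<longleftrightarrow> \<sigma>' \<in> insertions x (m - 1) l j (y # w)"
        unfolding insertions_def using Cons True by (simp add: occurs_Cons)
      then show ?thesis using Cons True assms by auto
    next
      case False
      have "count_list \<sigma>' x = Suc j"
        if "length \<sigma>' = Suc j + length w" "filter (\<lambda>y. y \<noteq> x) \<sigma>' = w"
        using count_list_add_length_filter_neq[of \<sigma>' x] that by simp
      then have "\<sigma> \<in> insertions x m l (Suc j) (y # w) \<longleftrightarrow>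
          z = y \<and> \<not> (m = 0 \<and> l \<le> Suc j) \<and> \<sigma>' \<in> insertions x m l (Suc j) w"
        unfolding insertions_def using Cons False assms by (auto simp: occurs_Cons)
      then show ?thesis using Cons False by auto
    qed
  qed
  then show ?thesis by blast
qed

lemma finite_insertions [simp]: "finite (insertions x m l j w)"
proof (rule finite_subset)
  show "insertions x m l j w \<subseteq> {\<sigma>. set \<sigma> \<subseteq> insert x (set w) \<and> length \<sigma> = j + length w}"
    by (auto simp: insertions_def)
  show "finite {\<sigma>. set \<sigma> \<subseteq> insert x (set w) \<and> length \<sigma> = j + length w}"
    by (rule finite_lists_length_eq) simp
qed

text \<open>
  If \<open>m = l = 0\<close> and \<open>w\<close> is empty, then the truncated subtraction gives \<open>0 choose 0 = 1\<close>, which is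
  the correct value.
\<close>

lemma card_insertions:
  assumes "\<forall>y\<in>set w. x < y"
  shows "card (insertions x m l j w) = (min (Suc j) (m + l) + length w - 1) choose length w"
  using assms
proof (induction w arbitrary: m j)
  case Nil
  then show ?case by (simp add: insertions_Nil)
next
  case (Cons y w)
  then have xy: "x < y" by simp
  have IH: "card (insertions x m l j w) = (min (Suc j) (m + l) + length w - 1) choose length w" for m j
    using Cons by simp
  show ?case
  \<comment> \<open>The recursion shortens the word in one summand but only lowers \<open>j\<close>
    in the other, hence an induction on \<open>j\<close> inside the one on the word.\<close>
  proof (induction j arbitrary: m)
    case 0
    \<comment> \<open>The minimum is \<open>0\<close> only for \<open>m = l = 0\<close>; the
      binomial coefficient then vanishes, its lower index being one too large, and matches the empty
      set.\<close>
    have "min (Suc 0) (m + l) = (if m = 0 \<and> l = 0 then 0 else 1)" by auto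
    then show ?case using insertions_0[of "y # w" x m l] Cons.prems by simp
  next
    case (Suc j)
    let ?A = "(#) x ` insertions x (m - 1) l j (y # w)"
    let ?B = "if m = 0 \<and> l \<le> Suc j then {} else (#) y ` insertions x m l (Suc j) w"
    have "card (insertions x m l (Suc j) (y # w)) = card ?A + card ?B"
      unfolding insertions_Suc_Cons[OF xy] using xy by (intro card_Un_disjoint) auto
    also have "\<dots> = ((min (Suc j) (m - 1 + l) + length w) choose Suc (length w)) +
        (if m = 0 \<and> l \<le> Suc j then 0
         else (min (Suc (Suc j)) (m + l) + length w - 1) choose length w)"
      using Suc[of "m - 1"] IH[of m "Suc j"] by (simp add: card_image)
    also have "\<dots> = (min (Suc (Suc j)) (m + l) + length w) choose Suc (length w)"
    proof (cases "m = 0 \<and> l \<le> Suc j")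
      case True
      then have "min (Suc j) (m - 1 + l) = l" "min (Suc (Suc j)) (m + l) = l" by auto
      then show ?thesis using True by simp
    next
      case False
      \<comment> \<open>Either \<open>m > 0\<close>, or \<open>m = 0\<close> and
        \<open>l > Suc j\<close>: in both cases the second minimum is larger by one, and Pascal's
        rule applies.\<close>
      define t where "t = min (Suc j) (m - 1 + l)"
      have "min (Suc j) (m - 1 + l) = t" "min (Suc (Suc j)) (m + l) = Suc t"
        using False by (auto simp: t_def)
      then show ?thesis using False by auto
    qed
    finally show ?case by simp
  qed
qed

section \<open>Recursion over the alphabet size\<close>

lemma finite_words [simp]: "finite (words k n)"
proof -
  have "words k n = {\<sigma>. set \<sigma> \<subseteq> {1..k} \<and> length \<sigma> = n}" by (auto simp: words_def)
  then show ?thesis by (simp add: finite_lists_length_eq)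
qed

text \<open>Raising all letters by one keeps their relative order and carries
  \<open>{1..k - 1}\<close> to \<open>{2..k}\<close>.\<close>

lemma num_avoiding_eq_card_shifted:
  "num_avoiding \<tau> p (k - 1) =
    card {w. length w = p \<and> set w \<subseteq> {2..k} \<and> avoids w \<tau>}"
proof -
  have "{w. length w = p \<and> set w \<subseteq> {2..k} \<and> avoids w \<tau>} =
      map Suc ` {\<sigma> \<in> words (k - 1) p. avoids \<sigma> \<tau>}" (is "?L = ?R")
  proof
    show "?L \<subseteq> ?R"
    proof
      fix w assume w: "w \<in> ?L"
      then have e: "w = map Suc (map (\<lambda>y. y - 1) w)"
        by (auto simp: map_idI o_def subset_iff intro!: map_idI[symmetric])
      then have "avoids (map (\<lambda>y. y - 1) w) \<tau>"
        using w by (metis (mono_tags, lifting) avoids_map_Suc mem_Collect_eq)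
      then have "map (\<lambda>y. y - 1) w \<in> {\<sigma> \<in> words (k - 1) p. avoids \<sigma> \<tau>}"
        using w by (force simp: words_def)
      then show "w \<in> ?R" using e by blast
    qed
    show "?R \<subseteq> ?L" by (force simp: words_def avoids_map_Suc)
  qed
  moreover have "inj_on (map Suc) A" for A by (auto intro: inj_onI)
  ultimately show ?thesis by (simp add: num_avoiding_def card_image)
qed

text \<open>Avoiders are sorted by the word \<open>w\<close> of their letters other than
  \<open>1\<close>; how many belong to \<open>w\<close> depends only on its length
  \<open>p\<close>.\<close>

lemma num_avoiding_v_eq_sum:
  assumes "0 < m + l" "k \<ge> 1"
  shows "num_avoiding (v m l) n k =
    (\<Sum>p\<le>n. ((min (Suc (n - p)) (m + l) + p - 1) choose p) * num_avoiding (v m l) p (k - 1))"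
proof -
  define W where "W p = {w. length w = p \<and> set w \<subseteq> {2..k} \<and> avoids w (v m l)}" for p
  have finW: "finite (W p)" for p
    by (rule finite_subset[OF _ finite_lists_length_eq[of "{2..k}" p]]) (auto simp: W_def)
  have "{\<sigma> \<in> words k n. avoids \<sigma> (v m l)} =
      (\<Union>p\<le>n. \<Union>w\<in>W p. insertions 1 m l (n - p) w)" (is "?L = ?R")
  proof
    show "?L \<subseteq> ?R"
    proof
      fix \<sigma> assume s: "\<sigma> \<in> ?L"
      let ?w = "filter (\<lambda>y. y \<noteq> 1) \<sigma>"
      have "length ?w \<le> n" using s by (auto simp: words_def)
      moreover have "\<forall>y\<in>set \<sigma>. 1 \<le> y" using s by (auto simp: words_def)
      then have "\<not> occurs 1 m l \<sigma>" "avoids ?w (v m l)"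
        using s avoids_v_split_ones[OF assms(1), of \<sigma>] by blast+
      moreover have "set ?w \<subseteq> {2..k}" using s by (force simp: words_def)
      ultimately have "?w \<in> W (length ?w)" "\<sigma> \<in> insertions 1 m l (n - length ?w) ?w"
        using s by (auto simp: W_def insertions_def words_def)
      then show "\<sigma> \<in> ?R" using \<open>length ?w \<le> n\<close> by blast
    qed
    show "?R \<subseteq> ?L"
    proof
      fix \<sigma> assume "\<sigma> \<in> ?R"
      then obtain w where w: "length w \<le> n" "w \<in> W (length w)"
        and \<sigma>: "\<sigma> \<in> insertions 1 m l (n - length w) w"
        by (auto simp: W_def)
      then have f: "filter (\<lambda>y. y \<noteq> 1) \<sigma> = w" and no: "\<not> occurs 1 m l \<sigma>" and len: "length \<sigma> = n"
        by (auto simp: insertions_def)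
      have "set \<sigma> \<subseteq> insert 1 (set w)" using f by auto
      then have set: "set \<sigma> \<subseteq> {1..k}" using w(2) assms(2) by (force simp: W_def)
      then have "\<forall>y\<in>set \<sigma>. 1 \<le> y" by auto
      then show "\<sigma> \<in> ?L"
        using set avoids_v_split_ones[OF assms(1), of \<sigma>] f no len w(2) by (auto simp: W_def words_def)
    qed
  qed
  moreover have "card ?R = (\<Sum>p\<le>n. \<Sum>w\<in>W p. card (insertions 1 m l (n - p) w))"
  proof -
    \<comment> \<open>Filtering recovers \<open>w\<close> from an insertion, and its length recovers
      \<open>p\<close>; hence the unions are disjoint.\<close>
    have "card ?R = (\<Sum>p\<le>n. card (\<Union>w\<in>W p. insertions 1 m l (n - p) w))"
      by (rule card_UN_disjoint) (simp, simp add: finW, auto simp: W_def insertions_def)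
    also have "\<dots> = (\<Sum>p\<le>n. \<Sum>w\<in>W p. card (insertions 1 m l (n - p) w))"
      by (intro sum.cong refl card_UN_disjoint finW) (simp, auto simp: insertions_def)
    finally show ?thesis .
  qed
  moreover have "(\<Sum>w\<in>W p. card (insertions 1 m l (n - p) w)) =
      ((min (Suc (n - p)) (m + l) + p - 1) choose p) * num_avoiding (v m l) p (k - 1)" for p
  proof -
    have "card (insertions 1 m l (n - p) w) = (min (Suc (n - p)) (m + l) + p - 1) choose p"
      if "w \<in> W p" for w
      using that card_insertions[of w 1 m l "n - p"] by (force simp: W_def)
    moreover have "card (W p) = num_avoiding (v m l) p (k - 1)"
      by (simp only: W_def num_avoiding_eq_card_shifted)
    ultimately show ?thesis by simp
  qed
  ultimately show ?thesis by (simp add: num_avoiding_def)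
qed

section \<open>The difference formula\<close>

text \<open>The pattern is a single letter, which any nonempty word contains. This settles
  \<open>m + l = 0\<close>, where the sum is empty.\<close>

lemma num_avoiding_v_0_0:
  assumes "n \<ge> 1"
  shows "num_avoiding (v 0 0) n k = 0"
proof -
  have "contains \<sigma> (v 0 0)" if "length \<sigma> = n" for \<sigma>
    unfolding contains_def using assms that
    by (intro exI[of _ "\<lambda>_. 0"]) (auto simp: strict_mono_on_def)
  then have "{\<sigma> \<in> words k n. avoids \<sigma> (v 0 0)} = {}"
    by (auto simp: avoids_def words_def)
  then show ?thesis by (simp add: num_avoiding_def)
qed

theorem theorem13:
  fixes m l k n :: nat
  assumes "k \<ge> 1" and "n \<ge> 1"
  shows "int (num_avoiding (v m l) (n + 1) k) - int (num_avoiding (v m l) n k) =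
    (\<Sum>j<m + l. int (n choose j) * int (num_avoiding (v m l) (n + 1 - j) (k - 1)))"
proof (cases "m + l = 0")
  case True
  then show ?thesis using assms(2) by (simp add: num_avoiding_v_0_0)
next
  case False
  define s where "s = m + l"
  then have s: "0 < s" using False by simp
  define g where "g p = int (num_avoiding (v m l) p (k - 1))" for p
  define h where "h j p = (min (Suc j) s + p - 1) choose p" for j p
  have f: "int (num_avoiding (v m l) r k) = (\<Sum>p\<le>r. int (h (r - p) p) * g p)" for r
    using num_avoiding_v_eq_sum[of m l k r] False assms(1) by (simp add: g_def h_def s_def)
  \<comment> \<open>With fewer than \<open>s\<close> ones in the longer word, the values are
    \<open>Suc n choose p\<close> and \<open>n choose p\<close>; for \<open>p > 0\<close> they
    differ by \<open>n choose (p - 1)\<close>, rewritten by symmetry, and for \<open>p = 0\<close>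
    both sides are \<open>0\<close>. Otherwise both minima are \<open>s\<close>.\<close>
  have diff: "int (h (Suc (n - p)) p) - int (h (n - p) p) =
      (if Suc n - p < s then int (n choose (Suc n - p)) else 0)" if "p \<le> n" for p
  proof (cases "Suc n - p < s")
    case True
    then have "min (Suc (Suc (n - p))) s = Suc (Suc (n - p))" "min (Suc (n - p)) s = Suc (n - p)"
      using that by auto
    then have h: "h (Suc (n - p)) p = Suc n choose p" "h (n - p) p = n choose p"
      using that by (auto simp: h_def)
    show ?thesis
    proof (cases p)
      case 0
      then show ?thesis using h by simp
    next
      case (Suc q)
      moreover have "n choose (n - q) = n choose q" using Suc that by (simp add: binomial_symmetric[symmetric])
      ultimately show ?thesis using h True by simp
    qed
  next
    case False
    then have "min (Suc (Suc (n - p))) s = min (Suc (n - p)) s" using that by (simp add: min_def)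
    then show ?thesis using False by (simp add: h_def)
  qed
  \<comment> \<open>The term \<open>p = Suc n\<close>, without ones, has no partner; its coefficient
    is \<open>1\<close> because \<open>s > 0\<close>.\<close>
  have "int (num_avoiding (v m l) (n + 1) k) - int (num_avoiding (v m l) n k) =
      (\<Sum>p\<le>n. (int (h (Suc (n - p)) p) - int (h (n - p) p)) * g p) + g (Suc n)"
    using s by (simp add: f sum_subtractf left_diff_distrib Suc_diff_le h_def)
  \<comment> \<open>The lone term fits the same formula, as \<open>n choose 0 = 1\<close>.\<close>
  also have "\<dots> = (\<Sum>p\<le>Suc n. (if Suc n - p < s then int (n choose (Suc n - p)) else 0) * g p)"
    using s by (simp add: diff)
  also have "\<dots> = (\<Sum>j\<le>Suc n. (if j < s then int (n choose j) else 0) * g (Suc n - j))"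
    by (rule sum.reindex_bij_witness[of _ "\<lambda>j. Suc n - j" "\<lambda>j. Suc n - j"]) auto
  also have "\<dots> = (\<Sum>j\<in>{..Suc n} \<inter> {..<s}. int (n choose j) * g (Suc n - j))"
    by (rule sum.mono_neutral_cong_right) auto
  \<comment> \<open>For \<open>j > Suc n\<close> the factor \<open>n choose j\<close> vanishes, so
    the truncated \<open>Suc n - j\<close> does no harm.\<close>
  also have "\<dots> = (\<Sum>j<s. int (n choose j) * g (Suc n - j))"
    by (rule sum.mono_neutral_left) auto
  finally show ?thesis by (simp add: s_def g_def)
qed

end
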